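(* Let $(K,d)$ be an infinite compact metric space and let $X = C(K)$ be the Banach space of real-valued continuous functions on $K$ equipped with the supremum norm. Then there exist a nonempty weakly compact subset $C$ of $X$ and a function $f : X \to \mathbb{R}$, bounded below on $C$ and upper semi-continuous for the weak topology on $X$, such that the set $$D(C,f) = \{x \in X : \exists z \in C,\ r(x) = \|x-z\| - f(z)\}, \qquad r(x) = \sup\{\|x-z\| - f(z) : z \in C\},$$ is not (norm) dense in $X$.
   Context: The set $D(C,f)$ is the set of $x \in X$ such that the function $z \mapsto \|x-z\| - f(z)$ attains its supremum on $C$. *)

theory Defs
  imports "HOL-Analysis.Analysis"
begin

definition weak_topology :: "'x::real_normed_vector topology" where
  "weak_topology =
     topology_generated_by {blinfun_apply \<phi> -` U | (\<phi> :: 'x \<Rightarrow>\<^sub>L real) U. open U}"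

lemma topspace_weak_topology [simp]:
  "topspace (weak_topology :: 'x::real_normed_vector topology) = UNIV"
proof -
  have "blinfun_apply (0 :: 'x \<Rightarrow>\<^sub>L real) -` UNIV
      \<in> {blinfun_apply \<phi> -` U | (\<phi> :: 'x \<Rightarrow>\<^sub>L real) U. open U}"
    by blast
  then show ?thesis
    unfolding weak_topology_def topology_generated_by_topspace by auto
qed

definition upper_semicontinuous_map :: "'x topology \<Rightarrow> ('x \<Rightarrow> real) \<Rightarrow> bool" where
  "upper_semicontinuous_map T f \<longleftrightarrow> (\<forall>a. openin T {x \<in> topspace T. f x < a})"

(* The supremum is taken in the reals, hence meaningful only for z \<mapsto> norm (x - z) - f z
   bounded above on C; this holds for all x if C is norm bounded (for instance weakly compact)
   and f is bounded below on C. *)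
definition farthest_value ::
    "'x::real_normed_vector set \<Rightarrow> ('x \<Rightarrow> real) \<Rightarrow> 'x \<Rightarrow> real" where
  "farthest_value C f x = (SUP z\<in>C. norm (x - z) - f z)"

definition attaining_set ::
    "'x::real_normed_vector set \<Rightarrow> ('x \<Rightarrow> real) \<Rightarrow> 'x set" where
  "attaining_set C f = {x. \<exists>z\<in>C. farthest_value C f x = norm (x - z) - f z}"

end

(* Take disjoint bumps e n (an infinite compact K has an accumulation point), so that e n tends
   weakly to 0, and let C consist of the sums of two elements of {0, e 0, e 1, ...}. The penalty f
   is 3 at 0, e n and 2 e n, and 1 / (1 + max n m) at e n + e m for n and m distinct. For x close
   to the constant -1, norm (x - e n - e m) is the maximum of norm (x - e n) and norm (x - e m).
   Letting m tend to infinity, the supremum is at least A = (SUP n. norm (x - e n)), whereas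
   the positive penalty keeps every single value strictly below A. *)

theory Submission
  imports Defs
begin

section \<open>Weak topologies\<close>

lemma openin_weak_vimage:
  fixes \<phi> :: "'x::real_normed_vector \<Rightarrow>\<^sub>L real"
  assumes "open U"
  shows "openin weak_topology (blinfun_apply \<phi> -` U)"
  unfolding weak_topology_def using assms by (intro topology_generated_by_Basis) blast

lemma continuous_map_weak_blinfun:
  fixes \<phi> :: "'x::real_normed_vector \<Rightarrow>\<^sub>L real"
  shows "continuous_map weak_topology euclidean (blinfun_apply \<phi>)"
  unfolding continuous_map_alt using openin_weak_vimage[of _ \<phi>] by simp

text \<open>The weak topology is the initial topology of the bounded functionals, so continuity only
  has to be tested on the generating preimages.\<close>

lemma continuous_map_into_weak:
  fixes g :: "'a \<Rightarrow> 'x::real_normed_vector"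
  assumes "\<And>\<phi> :: 'x \<Rightarrow>\<^sub>L real. continuous_map T euclidean (\<lambda>a. \<phi> (g a))"
  shows "continuous_map T weak_topology g"
proof -
  have "openin T (g -` (blinfun_apply \<phi> -` U) \<inter> topspace T)"
    if "open U" for \<phi> :: "'x \<Rightarrow>\<^sub>L real" and U
    using assms[of \<phi>] that unfolding continuous_map_alt
    by (simp add: vimage_def)
  moreover have "g ` topspace T \<subseteq> \<Union>{blinfun_apply \<phi> -` U | (\<phi> :: 'x \<Rightarrow>\<^sub>L real) U. open U}"
    using topspace_weak_topology[where 'x='x]
    unfolding weak_topology_def topology_generated_by_topspace by simp
  ultimately show ?thesis
    unfolding weak_topology_def continuous_on_generated_topo_iff by blast
qed

lemma continuous_map_weak_add:
  "continuous_map (prod_topology weak_topology weak_topology) weak_topology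
     (\<lambda>(a, b). a + b :: 'x::real_normed_vector)"
proof (rule continuous_map_into_weak)
  fix \<phi> :: "'x \<Rightarrow>\<^sub>L real"
  have "continuous_map (prod_topology weak_topology weak_topology) euclidean
          (\<lambda>p. \<phi> (fst p) + \<phi> (snd p))"
    using continuous_map_compose[OF continuous_map_fst continuous_map_weak_blinfun[of \<phi>]]
      continuous_map_compose[OF continuous_map_snd continuous_map_weak_blinfun[of \<phi>]]
    by (intro continuous_map_add) (simp_all add: o_def)
  then show "continuous_map (prod_topology weak_topology weak_topology) euclidean
               (\<lambda>p. \<phi> (case p of (a, b) \<Rightarrow> a + b))"
    by (simp add: case_prod_beta blinfun.add_right)
qed

lemma compactin_weak_plus:
  fixes S T :: "'x::real_normed_vector set"
  assumes "compactin weak_topology S" "compactin weak_topology T"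
  shows "compactin weak_topology ((\<lambda>(a, b). a + b) ` (S \<times> T))"
  by (rule image_compactin[OF _ continuous_map_weak_add]) (simp add: compactin_Times assms)

text \<open>Induction on how a weakly open neighbourhood is generated: the hypothesis handles the
  generators, and the property passes to finite intersections and to unions.\<close>

lemma limitin_weak_topology:
  fixes s :: "'a \<Rightarrow> 'x::real_normed_vector"
  assumes "\<And>\<phi> :: 'x \<Rightarrow>\<^sub>L real. ((\<lambda>n. \<phi> (s n)) \<longlongrightarrow> \<phi> l) F"
  shows "limitin weak_topology s l F"
  unfolding limitin_def
proof (intro conjI allI impI)
  fix V :: "'x set"
  assume "openin weak_topology V \<and> l \<in> V"
  then have "generate_topology_on {blinfun_apply \<phi> -` U | (\<phi> :: 'x \<Rightarrow>\<^sub>L real) U. open U} V" "l \<in> V"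
    by (simp_all add: weak_topology_def openin_topology_generated_by_iff)
  then show "\<forall>\<^sub>F n in F. s n \<in> V"
  proof (induction rule: generate_topology_on.induct)
    case (Int a b)
    then show ?case by (auto intro: eventually_conj)
  next
    case (UN K)
    then obtain k where "k \<in> K" "\<forall>\<^sub>F n in F. s n \<in> k" by blast
    then show ?case by (auto elim: eventually_mono)
  next
    case (Basis V)
    then obtain \<phi> :: "'x \<Rightarrow>\<^sub>L real" and U where "V = blinfun_apply \<phi> -` U" "open U" by blast
    with Basis assms[of \<phi>] show ?case by (auto simp: tendsto_def)
  qed simp
qed simp

text \<open>Point evaluations are bounded functionals and already separate functions. This later
  makes weakly compact sets weakly closed.\<close>

lemma Hausdorff_space_weak_bcontfun:
  "Hausdorff_space (weak_topology :: ('k::topological_space \<Rightarrow>\<^sub>C real) topology)"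
  unfolding Hausdorff_space_def
proof (intro allI impI)
  fix y z :: "'k \<Rightarrow>\<^sub>C real"
  assume "y \<in> topspace weak_topology \<and> z \<in> topspace weak_topology \<and> y \<noteq> z"
  then obtain t where "apply_bcontfun y t \<noteq> apply_bcontfun z t"
    using bcontfun_eqI by blast
  from hausdorff[OF this] obtain U V where UV: "open U" "open V" "apply_bcontfun y t \<in> U" "apply_bcontfun z t \<in> V"
      "U \<inter> V = {}"
    by blast
  have lin: "bounded_linear (\<lambda>z :: 'k \<Rightarrow>\<^sub>C real. apply_bcontfun z t)"
  proof (rule bounded_linear_intro)
    show "norm (apply_bcontfun z t) \<le> norm z * 1" for z :: "'k \<Rightarrow>\<^sub>C real"
      using norm_bounded[of z t] by simp
  qed simp_all
  define \<phi> where "\<phi> = Blinfun (\<lambda>z :: 'k \<Rightarrow>\<^sub>C real. apply_bcontfun z t)"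
  have \<phi>: "blinfun_apply \<phi> z = apply_bcontfun z t" for z
    by (simp add: \<phi>_def bounded_linear_Blinfun_apply[OF lin])
  show "\<exists>A B. openin weak_topology A \<and> openin weak_topology B \<and> y \<in> A \<and> z \<in> B \<and> disjnt A B"
    using openin_weak_vimage[of U \<phi>] openin_weak_vimage[of V \<phi>] UV
    by (intro exI[of _ "blinfun_apply \<phi> -` U"] exI[of _ "blinfun_apply \<phi> -` V"])
       (auto simp: \<phi> disjnt_def)
qed

section \<open>Disjoint bumps\<close>

text \<open>Take \<open>q\<close> to be an accumulation point and choose the \<open>p n\<close> one
  after another, each less than half as far from \<open>q\<close> as its predecessor.\<close>

lemma infinite_compact_imp_distances:
  assumes "compact (UNIV :: 'k::metric_space set)" "infinite (UNIV :: 'k set)"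
  obtains q and p :: "nat \<Rightarrow> 'k::metric_space" where "\<And>n. 0 < dist (p n) q"
    "\<And>n m. n < m \<Longrightarrow> 2 * dist (p m) q < dist (p n) q"
proof -
  obtain q :: 'k where "q islimpt UNIV"
    using Heine_Borel_imp_Bolzano_Weierstrass[OF assms subset_UNIV] by blast
  then have ex: "\<exists>y. y \<noteq> q \<and> dist y q < \<epsilon>" if "0 < \<epsilon>" for \<epsilon>
    using that by (auto simp: islimpt_approachable)
  obtain p where p: "\<And>n. p n \<noteq> q \<and> 2 * dist (p (Suc n)) q < dist (p n) q"
  proof -
    have "\<exists>p. \<forall>n. p n \<noteq> q \<and> 2 * dist (p (Suc n)) q < dist (p n) q"
    proof (rule dependent_nat_choice)
      show "\<exists>x. x \<noteq> q" using ex[of 1] by auto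
      show "\<exists>y. y \<noteq> q \<and> 2 * dist y q < dist x q" if "x \<noteq> q" for x and n :: nat
        using ex[of "dist x q / 2"] that by auto
    qed
    then show thesis using that by blast
  qed
  have "2 * dist (p m) q < dist (p n) q" if "n < m" for n m
    using that
  proof (induction rule: strict_inc_induct)
    case (step i)
    then show ?case using p[of i] zero_le_dist[of "p (Suc i)" q] by linarith
  qed (use p in simp)
  then show thesis using that[of p q] p by simp
qed

text \<open>The points \<open>p n\<close> serve to detect which bumps occur in a given sum, and
  hence to recover its indices.\<close>

locale disjoint_bumps =
  fixes e :: "nat \<Rightarrow> 'k::topological_space \<Rightarrow>\<^sub>C real" and p :: "nat \<Rightarrow> 'k"
  assumes nonneg: "0 \<le> apply_bcontfun (e n) t"
    and le_1: "apply_bcontfun (e n) t \<le> 1"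
    and disjoint: "n \<noteq> m \<Longrightarrow> apply_bcontfun (e n) t = 0 \<or> apply_bcontfun (e m) t = 0"
    and peak: "apply_bcontfun (e n) (p n) = 1"

lemma disjoint_bumps_exist:
  assumes "compact (UNIV :: 'k::metric_space set)" "infinite (UNIV :: 'k set)"
  obtains e and p :: "nat \<Rightarrow> 'k::metric_space" where "disjoint_bumps e p"
proof -
  obtain q and p :: "nat \<Rightarrow> 'k" where pos: "\<And>n. 0 < dist (p n) q"
    and dec: "\<And>n m. n < m \<Longrightarrow> 2 * dist (p m) q < dist (p n) q"
    using infinite_compact_imp_distances[OF assms] by metis
  \<comment> \<open>Let \<open>r n\<close> be the distance from \<open>p n\<close> to
    \<open>q\<close>. The tent \<open>b n\<close> lives on the shell where the distance to
    \<open>q\<close> is strictly between 3/4 and 5/4 of \<open>r n\<close>. For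
    \<open>n < m\<close>, 5/4 of \<open>r m\<close> is less than 5/8 of \<open>r n\<close>, so the
    shells are disjoint.\<close>
  define b where "b n t = max 0 (1 - 4 * \<bar>dist t q - dist (p n) q\<bar> / dist (p n) q)" for n t
  have b01: "0 \<le> b n t" "b n t \<le> 1" for n t
    by (auto simp: b_def)
  have bc: "b n \<in> bcontfun" for n
  proof (rule bcontfun_normI)
    show "continuous_on UNIV (b n)"
      unfolding b_def by (intro continuous_intros) (use pos[of n] in auto)
    show "norm (b n t) \<le> 1" for t using b01[of n t] by simp
  qed
  have near: "4 * \<bar>dist t q - dist (p n) q\<bar> < dist (p n) q" if "b n t \<noteq> 0" for n t
  proof (rule ccontr)
    assume "\<not> ?thesis"
    then have "1 \<le> 4 * \<bar>dist t q - dist (p n) q\<bar> / dist (p n) q"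
      by (subst le_divide_eq_1_pos[OF pos]) simp
    then show False using that unfolding b_def by linarith
  qed
  have less: "b n t = 0 \<or> b m t = 0" if "n < m" for n m t
  proof (rule ccontr)
    assume "\<not> (b n t = 0 \<or> b m t = 0)"
    then show False using near[of n t] near[of m t] dec[OF that] pos[of n] by argo
  qed
  have "disjoint_bumps (\<lambda>n. Bcontfun (b n)) p"
  proof
    show "apply_bcontfun (Bcontfun (b n)) t = 0 \<or> apply_bcontfun (Bcontfun (b m)) t = 0"
      if "n \<noteq> m" for n m t
      using that less[of n m t] less[of m n t] by (auto simp: Bcontfun_inverse bc neq_iff)
    show "apply_bcontfun (Bcontfun (b n)) (p n) = 1" for n
      by (simp add: Bcontfun_inverse bc) (simp add: b_def)
  qed (simp_all add: Bcontfun_inverse bc b01)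
  then show thesis by (rule that)
qed

lemma norm_bcontfun_mono:
  fixes x y :: "'k::topological_space \<Rightarrow>\<^sub>C real"
  assumes "\<And>t. \<bar>apply_bcontfun x t\<bar> \<le> \<bar>apply_bcontfun y t\<bar>"
  shows "norm x \<le> norm y"
proof (rule norm_bound)
  show "norm (apply_bcontfun x t) \<le> norm y" for t
    using assms[of t] norm_bounded[of y t] by simp
qed

lemma apply_bcontfun_sum:
  fixes g :: "'i \<Rightarrow> 'k::topological_space \<Rightarrow>\<^sub>C real"
  shows "apply_bcontfun (sum g I) t = (\<Sum>i\<in>I. apply_bcontfun (g i) t)"
  by (induction I rule: infinite_finite_induct) auto

section \<open>Weak convergence of disjoint bumps to zero\<close>

context disjoint_bumps
begin

lemma apply_peak [simp]: "apply_bcontfun (e n) (p m) = (if n = m then 1 else 0)"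
  using disjoint[of n m "p m"] peak[of m] by auto

lemma norm_le_1: "norm (e n) \<le> 1"
  by (rule norm_bound) (use nonneg le_1 in auto)

lemma sum_le_1: "(\<Sum>n<N. apply_bcontfun (e n) t) \<le> 1"
proof (cases "\<exists>k<N. apply_bcontfun (e k) t \<noteq> 0")
  case True
  then obtain k where k: "k < N" "apply_bcontfun (e k) t \<noteq> 0" by blast
  then have "(\<Sum>n<N. apply_bcontfun (e n) t) = (\<Sum>n\<in>{k}. apply_bcontfun (e n) t)"
    by (intro sum.mono_neutral_right) (use disjoint in auto)
  then show ?thesis using le_1 by simp
qed (simp add: sum.neutral)

text \<open>By disjointness, combinations of bumps with coefficients of modulus at most 1 stay in
  the unit ball. Choosing the signs of \<open>\<phi> (e n)\<close> as coefficients bounds the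
  partial sums of \<open>\<bar>\<phi> (e n)\<bar>\<close> by \<open>norm \<phi>\<close>, so the
  series converges and its terms tend to 0.\<close>

lemma weakly_null:
  fixes \<phi> :: "('k \<Rightarrow>\<^sub>C real) \<Rightarrow>\<^sub>L real"
  shows "(\<lambda>n. \<phi> (e n)) \<longlonglongrightarrow> 0"
proof -
  have "(\<Sum>n<N. \<bar>\<phi> (e n)\<bar>) \<le> norm \<phi>" for N
  proof -
    define z where "z = (\<Sum>n<N. sgn (\<phi> (e n)) *\<^sub>R e n)"
    have "norm z \<le> 1"
    proof (rule norm_bound)
      fix t
      have "norm (apply_bcontfun z t) \<le> (\<Sum>n<N. \<bar>sgn (\<phi> (e n)) * apply_bcontfun (e n) t\<bar>)"
        by (simp add: z_def apply_bcontfun_sum sum_abs)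
      also have "\<dots> \<le> (\<Sum>n<N. apply_bcontfun (e n) t)"
        by (intro sum_mono) (use nonneg in \<open>simp add: abs_mult abs_sgn_eq\<close>)
      finally show "norm (apply_bcontfun z t) \<le> 1" using sum_le_1[of t N] by linarith
    qed
    have "(\<Sum>n<N. \<bar>\<phi> (e n)\<bar>) = \<phi> z"
      by (simp add: z_def blinfun.sum_right blinfun.scaleR_right abs_sgn mult.commute)
    also have "\<dots> \<le> norm \<phi> * norm z"
      using norm_blinfun[of \<phi> z] by simp
    also have "\<dots> \<le> norm \<phi>"
      using \<open>norm z \<le> 1\<close> by (simp add: mult_left_le)
    finally show ?thesis .
  qed
  then have "summable (\<lambda>n. \<bar>\<phi> (e n)\<bar>)"
    by (intro summableI_nonneg_bounded) auto
  then show ?thesis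
    using summable_LIMSEQ_zero tendsto_rabs_zero_iff by blast
qed

section \<open>The weakly compact set and its penalty\<close>

lemma compactin_multiples: "compactin weak_topology (insert 0 (range (\<lambda>n. c *\<^sub>R e n)))"
proof (rule compactin_sequence_with_limit)
  show "limitin weak_topology (\<lambda>n. c *\<^sub>R e n) 0 sequentially"
    by (rule limitin_weak_topology)
       (use tendsto_mult_right_zero[OF weakly_null] in \<open>simp add: blinfun.scaleR_right\<close>)
qed simp_all

text \<open>These are the degenerate pair sums, among them the weak limits 0 and \<open>e n\<close>
  of sequences of proper pair sums. The factor 1 is kept so that \<open>compactin_multiples\<close>
  applies to both halves.\<close>

definition singles :: "('k \<Rightarrow>\<^sub>C real) set" where
  "singles = insert 0 (range (\<lambda>n. 1 *\<^sub>R e n)) \<union> insert 0 (range (\<lambda>n. 2 *\<^sub>R e n))"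

definition pair_sums :: "('k \<Rightarrow>\<^sub>C real) set" where
  "pair_sums = (\<lambda>(a, b). a + b) `
     (insert 0 (range (\<lambda>n. 1 *\<^sub>R e n)) \<times> insert 0 (range (\<lambda>n. 1 *\<^sub>R e n)))"

text \<open>The maximum is meant for \<open>e n + e m\<close> with \<open>n \<noteq> m\<close>, where it equals \<open>max n m\<close>.\<close>

definition penalty :: "('k \<Rightarrow>\<^sub>C real) \<Rightarrow> real" where
  "penalty z = (if z \<in> singles then 3
     else if z \<in> pair_sums then 1 / (1 + real (Max {n. apply_bcontfun z (p n) \<noteq> 0})) else 0)"

lemma compactin_pair_sums: "compactin weak_topology pair_sums"
  unfolding pair_sums_def by (intro compactin_weak_plus compactin_multiples)

lemma compactin_singles: "compactin weak_topology singles"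
  unfolding singles_def by (intro compactin_Un compactin_multiples)

lemma pair_sums_cases:
  assumes "z \<in> pair_sums"
  obtains "z = 0" | n where "z = e n" | n where "z = 2 *\<^sub>R e n" | n m where "n \<noteq> m" "z = e n + e m"
proof -
  consider "z = 0" | n where "z = e n" | n m where "z = e n + e m"
    using assms by (auto simp: pair_sums_def)
  then show thesis
  proof cases
    case (3 n m)
    then show thesis using that(3)[of n] that(4)[of n m] by (cases "n = m") (auto simp: scaleR_2)
  qed (use that in blast)+
qed

lemma in_singles: "0 \<in> singles" "e n \<in> singles" "2 *\<^sub>R e n \<in> singles"
  by (auto simp: singles_def)

lemma in_pair_sums: "0 \<in> pair_sums" "e n + e m \<in> pair_sums"
  unfolding pair_sums_def
  by (rule image_eqI[of _ _ "(0, 0)"], simp, simp)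
     (rule image_eqI[of _ _ "(e n, e m)"], simp_all)

lemma singles_subset_pair_sums: "singles \<subseteq> pair_sums"
proof -
  have "e n \<in> pair_sums" for n
    unfolding pair_sums_def by (rule image_eqI[of _ _ "(0, e n)"]) simp_all
  then show ?thesis
    using in_pair_sums by (auto simp: singles_def scaleR_2)
qed

lemma penalty_singles: "z \<in> singles \<Longrightarrow> penalty z = 3"
  by (simp add: penalty_def)

text \<open>The peaks decide everything: a multiple of one bump is nonzero at no more than one peak,
  whereas \<open>e n + e m\<close> is nonzero at exactly \<open>p n\<close> and
  \<open>p m\<close>.\<close>

lemma penalty_pair:
  assumes "n \<noteq> m"
  shows "penalty (e n + e m) = 1 / (1 + real (max n m))"
proof -
  have "e n + e m \<notin> singles"
  proof
    assume "e n + e m \<in> singles"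
    \<comment> \<open>The element 0 is treated as \<open>0 *\<^sub>R e 0\<close>, so that every
      element is a multiple of a single bump.\<close>
    moreover have "\<exists>k c. z = c *\<^sub>R e k" if "z \<in> singles" for z
      using that scaleR_zero_left[of "e 0", symmetric] unfolding singles_def by blast
    ultimately obtain k c where eq: "e n + e m = c *\<^sub>R e k" by blast
    have "apply_bcontfun (e n + e m) (p n) = 1" "apply_bcontfun (e n + e m) (p m) = 1"
      using assms by auto
    then show False using assms by (auto simp: eq split: if_splits)
  qed
  moreover have "{k. apply_bcontfun (e n + e m) (p k) \<noteq> 0} = {n, m}"
    using assms by auto
  ultimately show ?thesis using in_pair_sums by (simp add: penalty_def)
qed

lemma penalty_pos: "z \<in> pair_sums \<Longrightarrow> 0 < penalty z"
  by (simp add: penalty_def)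

text \<open>For positive \<open>a\<close>, the superlevel set consists of all or none of
  \<open>singles\<close>, where the penalty is constant, and finitely many proper pair sums. It is
  thus weakly compact, hence weakly closed.\<close>

lemma upper_semicontinuous_penalty: "upper_semicontinuous_map weak_topology penalty"
  unfolding upper_semicontinuous_map_def
proof
  fix a :: real
  define L where "L = {z. a \<le> penalty z}"
  have "closedin weak_topology L"
  proof (cases "a \<le> 0")
    case True
    have "0 \<le> penalty z" for z by (simp add: penalty_def)
    with True have "a \<le> penalty z" for z by (meson order_trans)
    then have "L = topspace weak_topology" by (simp add: L_def)
    then show ?thesis using closedin_topspace[of "weak_topology :: ('k \<Rightarrow>\<^sub>C real) topology"] by simp
  next
    case False
    \<comment> \<open>A proper pair sum has penalty at least \<open>a\<close> only if
      \<open>1 + max n m\<close> is at most \<open>1 / a\<close>, which bounds both indices by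
      \<open>N\<close>.\<close>
    define N where "N = nat \<lceil>1 / a\<rceil>"
    define F where "F = (\<lambda>(n, m). e n + e m) ` ({..N} \<times> {..N})"
    have sub: "L \<subseteq> singles \<union> F"
    proof
      fix z assume "z \<in> L"
      then have az: "a \<le> penalty z" by (simp add: L_def)
      with False have "z \<in> pair_sums" 
        using singles_subset_pair_sums by (auto simp: penalty_def split: if_splits)
      then show "z \<in> singles \<union> F"
      proof (cases rule: pair_sums_cases)
        case (4 n m)
        then have "a \<le> 1 / (1 + real (max n m))" using az penalty_pair by simp
        then have "1 + real (max n m) \<le> 1 / a"
          using False by (simp add: field_simps)
        then have "max n m \<le> N" unfolding N_def by linarith
        then show ?thesis using 4 by (auto simp: F_def)
      qed (auto simp: in_singles)
    qed
    have "L = (if a \<le> 3 then singles else {}) \<union> (L \<inter> F)"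
      using sub by (auto simp: L_def penalty_singles)
    moreover have "finite (L \<inter> F)" by (auto simp: F_def)
    then have "compactin weak_topology (L \<inter> F)" by (simp add: finite_imp_compactin)
    moreover have "compactin weak_topology (if a \<le> 3 then singles else {})"
      by (simp add: compactin_singles)
    ultimately have "compactin weak_topology L"
      using compactin_Un by metis
    then show ?thesis
      using compactin_imp_closedin Hausdorff_space_weak_bcontfun by blast
  qed
  moreover have "{z \<in> topspace weak_topology. penalty z < a} = topspace weak_topology - L"
    by (auto simp: L_def)
  ultimately show "openin weak_topology {z \<in> topspace weak_topology. penalty z < a}"
    unfolding closedin_def by simp
qed

section \<open>Failure of attainment at nonpositive functions\<close>

lemma not_attained:
  assumes neg: "\<And>t. apply_bcontfun x t \<le> 0"
  shows "x \<notin> attaining_set pair_sums penalty"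
proof
  assume "x \<in> attaining_set pair_sums penalty"
  then obtain z where z: "z \<in> pair_sums"
    and att: "farthest_value pair_sums penalty x = norm (x - z) - penalty z"
    by (auto simp: attaining_set_def)
  define A where "A = (SUP n. norm (x - e n))"
  have "norm (x - e n) \<le> norm x + 1" for n
    using norm_triangle_ineq4[of x "e n"] norm_le_1[of n] by linarith
  then have bdd: "bdd_above (range (\<lambda>n. norm (x - e n)))"
    by (intro bdd_aboveI[of _ "norm x + 1"]) auto
  have le_A: "norm (x - e n) \<le> A" for n
    unfolding A_def using bdd by (rule cSUP_upper2[of _ _ n]) auto
  \<comment> \<open>On \<open>singles\<close> the norm is at most \<open>A + 1\<close>, the worst
    case being \<open>2 *\<^sub>R e n\<close>, and the penalty 3 outweighs this excess. On proper
    pair sums the norm is at most \<open>A\<close>, and any positive penalty makes the inequality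
    strict.\<close>
  have less_A: "norm (x - y) - penalty y < A" if "y \<in> pair_sums" for y
    using that
  proof (cases rule: pair_sums_cases)
    case 1
    have "norm x \<le> norm (x - e 0)"
    proof (rule norm_bcontfun_mono)
      show "\<bar>apply_bcontfun x t\<bar> \<le> \<bar>apply_bcontfun (x - e 0) t\<bar>" for t
        using neg[of t] nonneg[of 0 t] by simp
    qed
    then show ?thesis using le_A[of 0] 1 in_singles by (simp add: penalty_singles)
  next
    case (2 n)
    then show ?thesis using le_A[of n] in_singles by (simp add: penalty_singles)
  next
    case (3 n)
    have "norm (x - 2 *\<^sub>R e n) \<le> norm (x - e n) + norm (e n)"
      using norm_triangle_ineq4[of "x - e n" "e n"] by (simp add: scaleR_2 algebra_simps)
    then show ?thesis
      using le_A[of n] norm_le_1[of n] in_singles(3)[of n] 3 by (simp add: penalty_singles)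
  next
    case (4 n m)
    have "norm (x - y) \<le> A"
    proof (rule norm_bound)
      fix t
      \<comment> \<open>At each point one of the two bumps vanishes, so only the other one is felt
        there.\<close>
      have "apply_bcontfun (x - y) t = apply_bcontfun (x - e m) t
          \<or> apply_bcontfun (x - y) t = apply_bcontfun (x - e n) t"
        using disjoint[OF 4(1), of t] by (auto simp: 4)
      then show "norm (apply_bcontfun (x - y) t) \<le> A"
        using norm_bounded[of "x - e n" t] norm_bounded[of "x - e m" t] le_A[of n] le_A[of m]
        by auto
    qed
    then show ?thesis using penalty_pos[OF that] by linarith
  qed
  \<comment> \<open>Boundedness is what makes the real supremum in \<open>farthest_value\<close> an
    upper bound of the values.\<close>
  have bdd_C: "bdd_above ((\<lambda>y. norm (x - y) - penalty y) ` pair_sums)"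
    using less_A by (intro bdd_aboveI[of _ A]) (auto intro: less_imp_le)
  have "norm (x - e n) \<le> farthest_value pair_sums penalty x" for n
  proof (rule field_le_epsilon)
    fix \<epsilon> :: real assume "0 < \<epsilon>"
    \<comment> \<open>Taking \<open>m\<close> above \<open>n\<close> makes the two bumps distinct
      and \<open>max n m\<close> equal to \<open>m\<close>, so the penalty of
      \<open>e n + e m\<close> is below \<open>\<epsilon>\<close>.\<close>
    then obtain m where m: "n < m" "1 / (1 + real m) < \<epsilon>"
    proof -
      obtain k where "inverse (real (Suc k)) < \<epsilon>" using reals_Archimedean \<open>0 < \<epsilon>\<close> by blast
      moreover have "1 / (1 + real (max k (Suc n))) \<le> inverse (real (Suc k))"
        by (simp add: field_simps)
      ultimately show thesis using that[of "max k (Suc n)"] by auto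
    qed
    \<comment> \<open>Since \<open>x\<close> is nonpositive, subtracting a further nonnegative bump
      can only increase the modulus at each point.\<close>
    have "norm (x - e n) \<le> norm (x - (e n + e m))"
    proof (rule norm_bcontfun_mono)
      show "\<bar>apply_bcontfun (x - e n) t\<bar> \<le> \<bar>apply_bcontfun (x - (e n + e m)) t\<bar>" for t
        using neg[of t] nonneg[of n t] nonneg[of m t] by simp
    qed
    also have "\<dots> = norm (x - (e n + e m)) - penalty (e n + e m) + 1 / (1 + real m)"
      using m(1) by (simp add: penalty_pair)
    also have "\<dots> \<le> farthest_value pair_sums penalty x + \<epsilon>"
      using m(2) cSUP_upper[OF in_pair_sums(2) bdd_C, of n m] unfolding farthest_value_def by linarith
    finally show "norm (x - e n) \<le> farthest_value pair_sums penalty x + \<epsilon>" .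
  qed
  then have "A \<le> farthest_value pair_sums penalty x"
    unfolding A_def by (intro cSUP_least) auto
  then show False using less_A[OF z] att by linarith
qed

end

text \<open>As the whole type is compact, every continuous real function on it is bounded, so
  \<open>'k \<Rightarrow>\<^sub>C real\<close> is the space C(K) with the supremum norm.\<close>

theorem mainTheorem2:
  assumes "compact (UNIV :: 'k::metric_space set)"
    and "infinite (UNIV :: 'k set)"
  shows "\<exists>(C :: ('k \<Rightarrow>\<^sub>C real) set) (f :: ('k \<Rightarrow>\<^sub>C real) \<Rightarrow> real).
           C \<noteq> {} \<and> compactin weak_topology C \<and>
           bdd_below (f ` C) \<and> upper_semicontinuous_map weak_topology f \<and>
           closure (attaining_set C f) \<noteq> UNIV"
proof -
  obtain e and p :: "nat \<Rightarrow> 'k" where "disjoint_bumps e p"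
    using disjoint_bumps_exist[OF assms] .
  then interpret disjoint_bumps e p .
  \<comment> \<open>Every function in the open unit ball around the constant -1 is negative, so
    \<open>not_attained\<close> excludes the whole ball.\<close>
  define x0 :: "'k \<Rightarrow>\<^sub>C real" where "x0 = const_bcontfun (- 1)"
  have "x \<notin> attaining_set pair_sums penalty" if "dist x x0 < 1" for x
  proof (rule not_attained)
    fix t
    have "dist (apply_bcontfun x t) (- 1) < 1"
      using dist_bounded[of x t x0] that by (simp add: x0_def const_bcontfun.rep_eq)
    then show "apply_bcontfun x t \<le> 0" by (simp add: dist_real_def)
  qed
  then have "x0 \<notin> closure (attaining_set pair_sums penalty)"
    unfolding closure_approachable using zero_less_one by blast
  moreover have "bdd_below (penalty ` pair_sums)"
    using penalty_pos by (auto intro!: bdd_belowI[of _ 0] less_imp_le)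
  ultimately show ?thesis
    using in_pair_sums(1) compactin_pair_sums upper_semicontinuous_penalty by blast
qed

end
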